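(* Let $S=\{x_1,\ldots,x_n\}$ be a finite collection of $n$ elements with a fixed initial listing, let $R$ be a binary relation on $S$, let $S_n$ be the group of permutations of $\{1,\ldots,n\}$ with operation $\ast$ (composition), and let $\rho$ be the equivalence relation on $S_n$ given by $(x,y)\in\rho$ if and only if $s(x)=s(y)$, where $s(x)$ is the IPC interpretation associated with $x\in S_n$. Then the partial operation $\odot$ on the quotient $S_n|\rho$ given by $$a\odot b=\begin{cases} c & \text{if } \{z: x\ast y=z,\ x\in a,\ y\in b\}|\rho = c\in S_n|\rho,\\ \infty & \text{otherwise}\end{cases}$$ is well defined; that is, for all $a,b\in S_n|\rho$ there is at most one $c\in S_n|\rho$ satisfying the first case.
   Context: Each $x\in S_n$ is identified with the counting (listing) $x_{x(1)},x_{x(2)},\ldots,x_{x(n)}$ of the collection $S$. The IPC (indiscernible predecessor based primitive counting) of a listing $y_1,\ldots,y_n$ relative to $R$ assigns formal symbols $f(y_i)=s^{r}(1_j)$ ($r\ge0$, $j\ge1$, with $s^0(1_j)=1_j$) recursively: $f(y_1)=1_1$; if $f(y_i)=s^r(1_j)$ and $(y_i,y_{i+1})\in R$, then $f(y_{i+1})=1_{j+1}$; if $f(y_i)=s^r(1_j)$ and $(y_i,y_{i+1})\notin R$, then $f(y_{i+1})=s^{r+1}(1_j)$. For $x\in S_n$, the IPC interpretation $s(x)$ is the sequence $(f(y_1),\ldots,f(y_n))$ of IPC symbols obtained for the listing associated with $x$. $S_n|\rho$ is the set of $\rho$-classes. The condition "$\{z: x\ast y=z,\ x\in a,\ y\in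 b\}|\rho=c\in S_n|\rho$" means that all products $x\ast y$ with $x\in a$, $y\in b$ lie in the single $\rho$-class $c$. The symbol $\infty$ means that $a\odot b$ is undefined. *)

theory Defs
  imports "HOL-Algebra.Sym_Groups" "HOL-Algebra.Coset"
begin

text \<open>The symbol $s^r(1_j)$ is \<open>(Succ ^^ r) (Unit j)\<close>; \<open>base\<close> recovers $j$.\<close>

datatype ipc_symbol = Unit nat | Succ ipc_symbol

primrec base :: "ipc_symbol \<Rightarrow> nat" where
  "base (Unit j) = j"
| "base (Succ t) = base t"

text \<open>Lists are indexed from 0, so \<open>ipc R ys i\<close> is $f(y_{i+1})$ for $i < n$.\<close>

primrec ipc :: "('a \<times> 'a) set \<Rightarrow> 'a list \<Rightarrow> nat \<Rightarrow> ipc_symbol" where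
  "ipc R ys 0 = Unit 1"
| "ipc R ys (Suc i) =
     (if (ys ! i, ys ! Suc i) \<in> R then Unit (base (ipc R ys i) + 1) else Succ (ipc R ys i))"

definition listing :: "nat \<Rightarrow> (nat \<Rightarrow> 'a) \<Rightarrow> (nat \<Rightarrow> nat) \<Rightarrow> 'a list" where
  "listing n x p = map (\<lambda>i. x (p i)) [1..<n + 1]"

definition ipc_interpretation ::
  "nat \<Rightarrow> (nat \<Rightarrow> 'a) \<Rightarrow> ('a \<times> 'a) set \<Rightarrow> (nat \<Rightarrow> nat) \<Rightarrow> ipc_symbol list" where
  "ipc_interpretation n x R p = map (ipc R (listing n x p)) [0..<n]"

definition ipc_rel ::
  "nat \<Rightarrow> (nat \<Rightarrow> 'a) \<Rightarrow> ('a \<times> 'a) set \<Rightarrow> ((nat \<Rightarrow> nat) \<times> (nat \<Rightarrow> nat)) set" where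
  "ipc_rel n x R = {(p, q). p \<in> carrier (sym_group n) \<and> q \<in> carrier (sym_group n) \<and>
     ipc_interpretation n x R p = ipc_interpretation n x R q}"

definition ipc_quotient ::
  "nat \<Rightarrow> (nat \<Rightarrow> 'a) \<Rightarrow> ('a \<times> 'a) set \<Rightarrow> (nat \<Rightarrow> nat) set set" where
  "ipc_quotient n x R = carrier (sym_group n) // ipc_rel n x R"

text \<open>The first case in the definition of $a \odot b$: $c$ is a class containing every
  product of an element of $a$ with an element of $b$.\<close>

definition is_ipc_product ::
  "nat \<Rightarrow> (nat \<Rightarrow> 'a) \<Rightarrow> ('a \<times> 'a) set \<Rightarrow>
    (nat \<Rightarrow> nat) set \<Rightarrow> (nat \<Rightarrow> nat) set \<Rightarrow> (nat \<Rightarrow> nat) set \<Rightarrow> bool" where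
  "is_ipc_product n x R a b c \<longleftrightarrow>
     c \<in> ipc_quotient n x R \<and> a <#>\<^bsub>sym_group n\<^esub> b \<subseteq> c"

text \<open>The partial operation $\odot$, with \<open>None\<close> for $\infty$. The description operator
  determines the value only once uniqueness of $c$ is known.\<close>

definition ipc_odot ::
  "nat \<Rightarrow> (nat \<Rightarrow> 'a) \<Rightarrow> ('a \<times> 'a) set \<Rightarrow>
    (nat \<Rightarrow> nat) set \<Rightarrow> (nat \<Rightarrow> nat) set \<Rightarrow> (nat \<Rightarrow> nat) set option" where
  "ipc_odot n x R a b =
     (if \<exists>c. is_ipc_product n x R a b c then Some (THE c. is_ipc_product n x R a b c) else None)"

end

theory Submission
  imports Defs
begin

text \<open>The operation takes whole classes, so no representatives are chosen; the only ambiguity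
  is in \<open>c\<close>. It is removed by \<open>is_ipc_product_unique\<close>, which rests on the
  partition given by \<open>equiv_ipc_rel\<close>.\<close>

text \<open>Classes of \<open>\<rho>\<close> are nonempty, so the product set of two of them is nonempty; any two classes
  containing it therefore meet and must coincide.\<close>

lemma equiv_ipc_rel: "equiv (carrier (sym_group n)) (ipc_rel n x R)"
  \<comment> \<open>On permutations, \<open>ipc_rel\<close> is the kernel of
    \<open>ipc_interpretation n x R\<close>, so it inherits the laws of equality.\<close>
  by (rule equivI) (auto simp: ipc_rel_def refl_on_def sym_def trans_def)

lemma is_ipc_product_unique:
  assumes "a \<in> ipc_quotient n x R" and "b \<in> ipc_quotient n x R"
    and c: "is_ipc_product n x R a b c" and d: "is_ipc_product n x R a b d"
  shows "c = d"
proof -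
  \<comment> \<open>An actual product is required: an empty product set would be contained in every
    class.\<close>
  obtain p q where "p \<in> a" "q \<in> b"
    using assms(1,2) in_quotient_imp_non_empty[OF equiv_ipc_rel] unfolding ipc_quotient_def by blast
  then have "p \<otimes>\<^bsub>sym_group n\<^esub> q \<in> a <#>\<^bsub>sym_group n\<^esub> b"
    unfolding set_mult_def by blast
  then show ?thesis
    using c d quotient_disj[OF equiv_ipc_rel]
    unfolding is_ipc_product_def ipc_quotient_def by blast
qed

theorem proposition4:
  fixes S :: "'a set" and n :: nat and x :: "nat \<Rightarrow> 'a" and R :: "('a \<times> 'a) set"
  assumes "bij_betw x {1..n} S" and "R \<subseteq> S \<times> S"
  shows "\<forall>a \<in> ipc_quotient n x R. \<forall>b \<in> ipc_quotient n x R.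
    (\<exists>\<^sub>\<le>\<^sub>1 c. is_ipc_product n x R a b c) \<and>
    (\<forall>c. ipc_odot n x R a b = Some c \<longleftrightarrow> is_ipc_product n x R a b c) \<and>
    (ipc_odot n x R a b = None \<longleftrightarrow> \<not> (\<exists>c. is_ipc_product n x R a b c))"
proof (intro ballI)
  fix a b assume ab: "a \<in> ipc_quotient n x R" "b \<in> ipc_quotient n x R"
  have unique: "\<exists>\<^sub>\<le>\<^sub>1 c. is_ipc_product n x R a b c"
    using is_ipc_product_unique[OF ab] by (rule Uniq_I)
  \<comment> \<open>Uniqueness makes \<open>THE\<close> return the class in question, so a value
    \<open>Some c\<close> is a genuine product.\<close>
  have "(THE c. is_ipc_product n x R a b c) = c" if "is_ipc_product n x R a b c" for c
    using unique that by (rule the1_equality')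
  then show "(\<exists>\<^sub>\<le>\<^sub>1 c. is_ipc_product n x R a b c) \<and>
    (\<forall>c. ipc_odot n x R a b = Some c \<longleftrightarrow> is_ipc_product n x R a b c) \<and>
    (ipc_odot n x R a b = None \<longleftrightarrow> \<not> (\<exists>c. is_ipc_product n x R a b c))"
    using unique unfolding ipc_odot_def by auto
qed

end
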